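(* Let $(M,*,0,\leq)$ be a dense unital magma and $(X,d)$ an $M$-metric space. Then any Cauchy sequence in $X$ having a convergent subsequence is convergent.
   Context: A unital magma $(M,*,0)$ is a set $M$ with a binary operation $*$ (not necessarily associative or commutative) and an element $0$ with $m*0=0*m=m$ for all $m$. An ordered unital magma $(M,*,0,\leq)$ is a unital magma with a partial ordering $\leq$ such that $a\leq b$ implies $a*c\leq b*c$ and $c*a\leq c*b$ for all $a,b,c\in M$. Write $a<b$ if $a\leq b$ and $a\neq b$; $m$ is positive if $0<m$. An ordered unital magma $M$ is a dense unital magma if for every positive $\epsilon\in M$ there are positive $\beta,\gamma\in M$ with $\beta*\gamma<\epsilon$. For an ordered unital magma $M$, $(X,d)$ is an $M$-metric space if $d:X\times X\to M$ satisfies, for all $x,y,z\in X$: (1) $d(x,y)\geq 0$, and $d(x,y)=0$ if and only if $x=y$; (2) $d(x,y)=d(y,x)$; (3) $d(x,z)\leq d(x,y)*d(y,z)$. A sequence $(x_n)$ in $X$ is convergent to $x\in X$ if for any positive $\epsilon\in M$ there is a natural number $N$ such that $n\geq N$ implies $d(x_n,x)<\epsilon$; it is convergent if it is convergent to some $x\in X$. It is a Cauchy sequence if for any positive $\epsilon\in M$ there is a natural number $N$ such that $m,n\geq N$ implies $d(x_m,x_n)<\epsilon$. *)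

theory Defs
  imports Main
begin

locale unital_magma =
  fixes M :: "'m set"
    and mult :: "'m \<Rightarrow> 'm \<Rightarrow> 'm" (infixl "\<star>" 70)
    and zero :: 'm ("\<zero>")
  assumes mult_closed: "\<lbrakk>a \<in> M; b \<in> M\<rbrakk> \<Longrightarrow> a \<star> b \<in> M"
    and zero_closed: "\<zero> \<in> M"
    and zero_left: "m \<in> M \<Longrightarrow> \<zero> \<star> m = m"
    and zero_right: "m \<in> M \<Longrightarrow> m \<star> \<zero> = m"

locale ordered_unital_magma = unital_magma M mult zero
  for M :: "'m set"
    and mult :: "'m \<Rightarrow> 'm \<Rightarrow> 'm" (infixl "\<star>" 70)
    and zero :: 'm ("\<zero>") +
  fixes le :: "'m \<Rightarrow> 'm \<Rightarrow> bool" (infix "\<preceq>" 50)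
  assumes le_refl: "reflp_on M (\<preceq>)"
    and le_antisym: "antisymp_on M (\<preceq>)"
    and le_trans: "transp_on M (\<preceq>)"
    and mult_right_mono: "\<lbrakk>a \<in> M; b \<in> M; c \<in> M; a \<preceq> b\<rbrakk> \<Longrightarrow> a \<star> c \<preceq> b \<star> c"
    and mult_left_mono: "\<lbrakk>a \<in> M; b \<in> M; c \<in> M; a \<preceq> b\<rbrakk> \<Longrightarrow> c \<star> a \<preceq> c \<star> b"

definition strictly :: "('m \<Rightarrow> 'm \<Rightarrow> bool) \<Rightarrow> 'm \<Rightarrow> 'm \<Rightarrow> bool" where
  "strictly le a b \<longleftrightarrow> le a b \<and> a \<noteq> b"

definition positives :: "'m set \<Rightarrow> 'm \<Rightarrow> ('m \<Rightarrow> 'm \<Rightarrow> bool) \<Rightarrow> 'm set" where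
  "positives M zero le = {m \<in> M. strictly le zero m}"

locale dense_unital_magma = ordered_unital_magma M mult zero le
  for M :: "'m set"
    and mult :: "'m \<Rightarrow> 'm \<Rightarrow> 'm" (infixl "\<star>" 70)
    and zero :: 'm ("\<zero>")
    and le :: "'m \<Rightarrow> 'm \<Rightarrow> bool" (infix "\<preceq>" 50) +
  assumes dense: "\<epsilon> \<in> positives M \<zero> (\<preceq>) \<Longrightarrow>
    \<exists>\<beta>\<in>positives M \<zero> (\<preceq>). \<exists>\<gamma>\<in>positives M \<zero> (\<preceq>). strictly (\<preceq>) (\<beta> \<star> \<gamma>) \<epsilon>"

locale magma_metric_space = ordered_unital_magma M mult zero le
  for M :: "'m set"
    and mult :: "'m \<Rightarrow> 'm \<Rightarrow> 'm" (infixl "\<star>" 70)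
    and zero :: 'm ("\<zero>")
    and le :: "'m \<Rightarrow> 'm \<Rightarrow> bool" (infix "\<preceq>" 50) +
  fixes X :: "'x set"
    and d :: "'x \<Rightarrow> 'x \<Rightarrow> 'm"
  assumes dist_closed: "\<lbrakk>x \<in> X; y \<in> X\<rbrakk> \<Longrightarrow> d x y \<in> M"
    and dist_nonneg: "\<lbrakk>x \<in> X; y \<in> X\<rbrakk> \<Longrightarrow> \<zero> \<preceq> d x y"
    and dist_eq_zero_iff: "\<lbrakk>x \<in> X; y \<in> X\<rbrakk> \<Longrightarrow> d x y = \<zero> \<longleftrightarrow> x = y"
    and dist_sym: "\<lbrakk>x \<in> X; y \<in> X\<rbrakk> \<Longrightarrow> d x y = d y x"
    and dist_triangle: "\<lbrakk>x \<in> X; y \<in> X; z \<in> X\<rbrakk> \<Longrightarrow> d x z \<preceq> d x y \<star> d y z"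

definition converges_to ::
  "'m set \<Rightarrow> 'm \<Rightarrow> ('m \<Rightarrow> 'm \<Rightarrow> bool) \<Rightarrow> ('x \<Rightarrow> 'x \<Rightarrow> 'm) \<Rightarrow> (nat \<Rightarrow> 'x) \<Rightarrow> 'x \<Rightarrow> bool" where
  "converges_to M zero le d s x \<longleftrightarrow>
    (\<forall>\<epsilon>\<in>positives M zero le. \<exists>N. \<forall>n\<ge>N. strictly le (d (s n) x) \<epsilon>)"

definition convergent_in ::
  "'m set \<Rightarrow> 'm \<Rightarrow> ('m \<Rightarrow> 'm \<Rightarrow> bool) \<Rightarrow> 'x set \<Rightarrow> ('x \<Rightarrow> 'x \<Rightarrow> 'm) \<Rightarrow> (nat \<Rightarrow> 'x) \<Rightarrow> bool" where
  "convergent_in M zero le X d s \<longleftrightarrow> (\<exists>x\<in>X. converges_to M zero le d s x)"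

definition cauchy_seq ::
  "'m set \<Rightarrow> 'm \<Rightarrow> ('m \<Rightarrow> 'm \<Rightarrow> bool) \<Rightarrow> ('x \<Rightarrow> 'x \<Rightarrow> 'm) \<Rightarrow> (nat \<Rightarrow> 'x) \<Rightarrow> bool" where
  "cauchy_seq M zero le d s \<longleftrightarrow>
    (\<forall>\<epsilon>\<in>positives M zero le. \<exists>N. \<forall>m\<ge>N. \<forall>n\<ge>N. strictly le (d (s m) (s n)) \<epsilon>)"

end

theory Submission
  imports Defs
begin

text \<open>This is the classical \<epsilon>/2 argument, with density supplying the two halves:
  positive \<beta>, \<gamma> whose product is below \<epsilon>. For large n the Cauchy property
  makes \<open>s n\<close> \<beta>-close to the subsequence term \<open>s (r n)\<close>, which is
  \<gamma>-close to the limit x of the subsequence. The triangle inequality and monotonicity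
  (\<open>mult_mono\<close>) bound \<open>d (s n) x\<close> by the product of \<beta> and \<gamma>,
  and \<open>le_strictly_trans\<close> turns this into a strict bound by \<epsilon>. So x is also
  the limit of the whole sequence.\<close>

context ordered_unital_magma
begin

text \<open>If a and c coincided, b would lie both above and below c, so antisymmetry would force b
  = c.\<close>

lemma le_strictly_trans:
  assumes "a \<in> M" "b \<in> M" "c \<in> M" "a \<preceq> b" "strictly (\<preceq>) b c"
  shows "strictly (\<preceq>) a c"
  using assms transp_onD[OF le_trans, of a b c] antisymp_onD[OF le_antisym, of b c]
  unfolding strictly_def by blast

text \<open>Replace one factor at a time, passing through \<open>a' \<star> b\<close>; this keeps
  the order of the factors, so commutativity is not assumed.\<close>

lemma mult_mono:
  assumes "a \<in> M" "b \<in> M" "a' \<in> M" "b' \<in> M" "a \<preceq> a'" "b \<preceq> b'"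
  shows "a \<star> b \<preceq> a' \<star> b'"
proof (rule transp_onD[OF le_trans])
  show "a \<star> b \<preceq> a' \<star> b" "a' \<star> b \<preceq> a' \<star> b'"
    using assms by (simp_all add: mult_left_mono mult_right_mono)
qed (use assms in \<open>simp_all add: mult_closed\<close>)

end

theorem theorem3p16:
  fixes M :: "'m set"
    and mult :: "'m \<Rightarrow> 'm \<Rightarrow> 'm"
    and zero :: 'm
    and le :: "'m \<Rightarrow> 'm \<Rightarrow> bool"
    and X :: "'x set"
    and d :: "'x \<Rightarrow> 'x \<Rightarrow> 'm"
    and s :: "nat \<Rightarrow> 'x"
  assumes "dense_unital_magma M mult zero le"
    and "magma_metric_space M mult zero le X d"
    and "range s \<subseteq> X"
    and "cauchy_seq M zero le d s"
    and "\<exists>r :: nat \<Rightarrow> nat. strict_mono r \<and> convergent_in M zero le X d (s \<circ> r)"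
  shows "convergent_in M zero le X d s"
proof -
  interpret dense_unital_magma M mult zero le by fact
  interpret magma_metric_space M mult zero le X d by fact
  obtain r x where r: "strict_mono r" and x: "x \<in> X"
    and lim: "converges_to M zero le d (s \<circ> r) x"
    using assms(5) unfolding convergent_in_def by blast
  have s: "s n \<in> X" for n using assms(3) by blast
  have "\<exists>N. \<forall>n\<ge>N. strictly le (d (s n) x) \<epsilon>" if \<epsilon>: "\<epsilon> \<in> positives M zero le" for \<epsilon>
  proof -
    obtain \<beta> \<gamma> where \<beta>: "\<beta> \<in> positives M zero le" and \<gamma>: "\<gamma> \<in> positives M zero le"
      and prod: "strictly le (mult \<beta> \<gamma>) \<epsilon>"
      using dense[OF \<epsilon>] by blast
    have M: "\<beta> \<in> M" "\<gamma> \<in> M" "\<epsilon> \<in> M"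
      using \<beta> \<gamma> \<epsilon> by (auto simp: positives_def)
    obtain N1 where N1: "\<And>m n. N1 \<le> m \<Longrightarrow> N1 \<le> n \<Longrightarrow> strictly le (d (s m) (s n)) \<beta>"
      using assms(4) \<beta> unfolding cauchy_seq_def by blast
    obtain N2 where N2: "\<And>n. N2 \<le> n \<Longrightarrow> strictly le (d (s (r n)) x) \<gamma>"
      using lim \<gamma> unfolding converges_to_def comp_def by blast
    have "strictly le (d (s n) x) \<epsilon>" if n: "max N1 N2 \<le> n" for n
    proof -
      \<comment> \<open>A single index n serves both bounds: n and \<open>r n\<close> are past
        \<open>N1\<close>, and n, as an index into the subsequence, is past
        \<open>N2\<close>.\<close>
      have "n \<le> r n" using strict_mono_imp_increasing[OF r] .
      \<comment> \<open>Strictness is dropped here because strict inequalities need not multiply to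
        a strict one; it comes back from the gap between the product of \<beta> and \<gamma> and
        \<epsilon>.\<close>
      then have "le (d (s n) (s (r n))) \<beta>" "le (d (s (r n)) x) \<gamma>"
        using n N1[of n "r n"] N2[of n] by (auto simp: strictly_def)
      then have "le (mult (d (s n) (s (r n))) (d (s (r n)) x)) (mult \<beta> \<gamma>)"
        by (simp add: mult_mono dist_closed s x M)
      then have "strictly le (mult (d (s n) (s (r n))) (d (s (r n)) x)) \<epsilon>"
        using prod le_strictly_trans[of _ "mult \<beta> \<gamma>"] by (simp add: mult_closed dist_closed s x M)
      then show ?thesis
        using dist_triangle[OF s s x, of n "r n"]
          le_strictly_trans[of _ "mult (d (s n) (s (r n))) (d (s (r n)) x)"]
        by (simp add: mult_closed dist_closed s x M)
    qed
    then show ?thesis by blast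
  qed
  then show ?thesis
    using x unfolding convergent_in_def converges_to_def by blast
qed

end
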